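(* Let $\mathbf{t}=01101001\cdots$ be the Thue–Morse word. Then $P(\mathbf{t}) = \frac{3}{10\ln2} \approx 0.4328$ and $p(\mathbf{t})=0$.
   Context: The Thue–Morse word $\mathbf{t}$ is the fixed point starting with $0$ of the morphism $\mu$ given by $\mu(0)=01$, $\mu(1)=10$. For a finite nonempty word $w$, an integer $p$ with $1\le p\le|w|$ is a period if $w[i]=w[i+p]$ for $1\le i\le |w|-p$; it is nontrivial if $p<|w|$; $\operatorname{nnp}(w)$ is the number of nontrivial periods; $\operatorname{per}(w)$ the least period; $\exp(w)=|w|/\operatorname{per}(w)$; $\operatorname{ice}(w)=\sup\{\exp(u): u \text{ a nonempty prefix of } w\}$. For a finite word $x$ with $|x|\ge2$ let $M(x)=\operatorname{nnp}(x)/(\operatorname{ice}(x)\ln|x|)$. For an infinite word $\mathbf{x}$ with length-$n$ prefix $Y_n$, define $P(\mathbf{x})=\limsup_{n\to\infty} M(Y_n)$ and $p(\mathbf{x})=\liminf_{n\to\infty} M(Y_n)$. *)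

theory Defs
  imports
    "HOL-Analysis.Analysis"
    "HOL-Library.Stream"
    "HOL-Library.Sublist"
    "HOL-Library.Z2"
begin

text \<open>
  Finite words are lists, infinite words are streams, so \<^term>\<open>stake n x\<close> is the prefix of length
  \<^term>\<open>n\<close>. List positions start at 0 instead of 1.
\<close>

definition is_period :: "'a list \<Rightarrow> nat \<Rightarrow> bool" where
  "is_period w p \<longleftrightarrow>
     1 \<le> p \<and> p \<le> length w \<and> (\<forall>i < length w - p. w ! i = w ! (i + p))"

definition nnp :: "'a list \<Rightarrow> nat" where
  "nnp w = card {p. is_period w p \<and> p < length w}"

definition per :: "'a list \<Rightarrow> nat" where
  "per w = (LEAST p. is_period w p)"

definition expo :: "'a list \<Rightarrow> real" where
  "expo w = real (length w) / real (per w)"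

definition ice :: "'a list \<Rightarrow> real" where
  "ice w = Sup {expo u | u. prefix u w \<and> u \<noteq> []}"

definition period_ratio :: "'a list \<Rightarrow> real" where
  "period_ratio w = real (nnp w) / (ice w * ln (real (length w)))"

text \<open>
  The values of \<^const>\<open>period_ratio\<close> on words of length less than 2 are meaningless; they do not
  affect the limits.
\<close>

definition upper_period_ratio :: "'a stream \<Rightarrow> ereal" where
  "upper_period_ratio x = limsup (\<lambda>n. ereal (period_ratio (stake n x)))"

definition lower_period_ratio :: "'a stream \<Rightarrow> ereal" where
  "lower_period_ratio x = liminf (\<lambda>n. ereal (period_ratio (stake n x)))"

definition mu :: "bit \<Rightarrow> bit list" where
  "mu a = (if a = 0 then [0, 1] else [1, 0])"

text \<open>The image of an infinite word \<^term>\<open>x\<close> under the morphism is \<^term>\<open>flat (smap mu x)\<close>.\<close>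

definition thue_morse :: "bit stream" where
  "thue_morse = (THE x. flat (smap mu x) = x \<and> shd x = 0)"

lemma length_mu [simp]: "length (mu a) = 2"
  by (simp add: mu_def)

lemma mu_nth_0 [simp]: "mu a ! 0 = a"
  by (cases a) (simp_all add: mu_def)

lemma snth_mu: "flat (smap mu x) !! n = mu (x !! (n div 2)) ! (n mod 2)"
proof (induction n arbitrary: x rule: less_induct)
  case (less n)
  have "mu (shd x) \<noteq> []"
    by (simp add: mu_def)
  then have eq: "flat (smap mu x) = mu (shd x) @- flat (smap mu (stl x))"
    by (subst flat_unfold) simp_all
  show ?case
  proof (cases "n < 2")
    case True
    then show ?thesis by (subst eq) simp
  next
    case False
    then obtain m where m: "n = m + 2"
      by (metis add.commute le_Suc_ex not_less)
    have "flat (smap mu x) !! n = flat (smap mu (stl x)) !! m"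
      by (subst eq, subst shift_snth_ge) (simp_all add: m)
    also have "\<dots> = mu (stl x !! (m div 2)) ! (m mod 2)"
      by (rule less.IH) (simp add: m)
    also have "\<dots> = mu (x !! (n div 2)) ! (n mod 2)"
      by (simp add: m)
    finally show ?thesis .
  qed
qed

fun tm_letter :: "nat \<Rightarrow> bit" where
  "tm_letter n = (if n = 0 then 0 else mu (tm_letter (n div 2)) ! (n mod 2))"

declare tm_letter.simps [simp del]

lemma mu_fixed_iff:
  "flat (smap mu x) = x \<and> shd x = 0 \<longleftrightarrow> x = smap tm_letter nats"
proof
  assume x: "flat (smap mu x) = x \<and> shd x = 0"
  have "x !! n = tm_letter n" for n
  proof (induction n rule: less_induct)
    case (less n)
    show ?case
    proof (cases "n = 0")
      case True
      then show ?thesis using x by (simp add: tm_letter.simps)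
    next
      case False
      have "x !! n = mu (x !! (n div 2)) ! (n mod 2)"
        using x snth_mu[of x n] by simp
      also have "\<dots> = tm_letter n"
        using False less.IH[of "n div 2"] by (subst tm_letter.simps) simp
      finally show ?thesis .
    qed
  qed
  then show "x = smap tm_letter nats"
    by (metis (no_types, lifting) ext stream_smap_nats)
next
  assume x: "x = smap tm_letter nats"
  have nth: "x !! n = tm_letter n" for n
    by (simp add: x)
  have zero: "tm_letter 0 = 0"
    by (simp add: tm_letter.simps)
  have "flat (smap mu x) !! n = x !! n" for n
  proof (cases "n = 0")
    case True
    then show ?thesis by (simp add: snth_mu nth zero del: snth.simps)
  next
    case False
    then have "tm_letter n = mu (tm_letter (n div 2)) ! (n mod 2)"
      by (subst tm_letter.simps) simp
    then show ?thesis by (simp only: snth_mu nth)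
  qed
  then have "flat (smap mu x) = x"
    by (metis (no_types, lifting) ext stream_smap_nats)
  moreover have "shd x = 0"
    using nth[of 0] zero by simp
  ultimately show "flat (smap mu x) = x \<and> shd x = 0" ..
qed

lemma thue_morse_unique: "\<exists>!x. flat (smap mu x) = x \<and> shd x = 0"
  by (simp add: mu_fixed_iff)

lemma thue_morse_fixed: "flat (smap mu thue_morse) = thue_morse" "shd thue_morse = 0"
  using theI'[OF thue_morse_unique] unfolding thue_morse_def by auto

lemma thue_morse_eq: "thue_morse = smap tm_letter nats"
  by (simp add: thue_morse_def mu_fixed_iff)

lemma thue_morse_start: "stake 8 thue_morse = [0, 1, 1, 0, 1, 0, 0, 1]"
proof -
  have 0: "tm_letter 0 = 0" by (subst tm_letter.simps) simp
  have 1: "tm_letter 1 = 1" by (subst tm_letter.simps) (simp add: 0 mu_def)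
  have 2: "tm_letter 2 = 1" by (subst tm_letter.simps) (simp add: 1[simplified])
  have 3: "tm_letter 3 = 0" by (subst tm_letter.simps) (simp add: 1[simplified] mu_def)
  have 4: "tm_letter 4 = 1" by (subst tm_letter.simps) (simp add: 2)
  have 5: "tm_letter 5 = 0" by (subst tm_letter.simps) (simp add: 2 mu_def)
  have 6: "tm_letter 6 = 0" by (subst tm_letter.simps) (simp add: 3)
  have 7: "tm_letter 7 = 1" by (subst tm_letter.simps) (simp add: 3 mu_def)
  show ?thesis
    using 0 1 2 3 4 5 6 7 by (simp add: thue_morse_eq stake_smap numeral_eq_Suc)
qed

end

theory Submission
  imports Defs "HOL-Real_Asymp.Real_Asymp"
begin

text \<open>Let \<open>t\<close> be the Thue--Morse word. Since \<open>t\<close> is fixed by the morphism, \<open>2p\<close> is a period of a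
  prefix of length \<open>n\<close> iff \<open>p\<close> is a period of the prefix of length \<open>\<lceil>n/2\<rceil>\<close>, while an odd shift of
  \<open>t\<close> agrees with \<open>t\<close> on at most two letters. Hence all exponents of prefixes are at most \<open>5/3\<close>, the
  value attained by 01101, and the number of nontrivial periods of the prefix of length \<open>N + 1\<close> counts
  those numbers among \<open>N\<close>, \<open>\<lfloor>N/2\<rfloor>\<close>, \<open>\<lfloor>N/4\<rfloor>\<close>, \dots that contribute an odd period. A potential
  argument shows that asymptotically at most half of them do. Half of them do for the length
  \<open>4\<^sup>k\<close>, and only the number 3 does for the length \<open>3\<cdot>2\<^sup>k + 1\<close>.\<close>

section \<open>Letters of the Thue--Morse word under doubling of the index\<close>

lemma tm_letter_0 [simp]: "tm_letter 0 = 0"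
  by (simp add: tm_letter.simps)

lemma tm_letter_double [simp]: "tm_letter (2 * n) = tm_letter n"
  by (cases "n = 0") (simp_all add: tm_letter.simps[of "2 * n"])

lemma tm_letter_Suc_double [simp]: "tm_letter (Suc (2 * n)) = tm_letter n + 1"
proof -
  have "tm_letter (Suc (2 * n)) = mu (tm_letter n) ! 1"
    by (simp add: tm_letter.simps[of "Suc (2 * n)"])
  then show ?thesis
    by (cases "tm_letter n") (simp_all add: mu_def)
qed

lemma tm_letter_1 [simp]: "tm_letter (Suc 0) = 1"
  using tm_letter_Suc_double[of 0] by simp

lemma tm_letter_2 [simp]: "tm_letter 2 = 1"
  using tm_letter_double[of 1] by simp

lemma tm_letter_3 [simp]: "tm_letter 3 = 0"
  using tm_letter_Suc_double[of 1] by simp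

lemma snth_thue_morse [simp]: "thue_morse !! n = tm_letter n"
  by (simp add: thue_morse_eq)

section \<open>Agreement of the word with its own shifts\<close>

definition tm_agree :: "nat \<Rightarrow> nat \<Rightarrow> bool" where
  "tm_agree p l \<longleftrightarrow> (\<forall>i<l. tm_letter i = tm_letter (i + p))"

lemma is_period_stake_thue_morse:
  "is_period (stake n thue_morse) p \<longleftrightarrow> 1 \<le> p \<and> p \<le> n \<and> tm_agree p (n - p)"
  by (auto simp: is_period_def tm_agree_def)

text \<open>An even shift maps blocks of the morphism to blocks, and two blocks agree iff their
  preimages do. A half block at the end still determines its preimage, hence the rounding
  up.\<close>

lemma tm_agree_double: "tm_agree (2 * p) l \<longleftrightarrow> tm_agree p ((l + 1) div 2)"
proof
  assume A: "tm_agree (2 * p) l"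
  show "tm_agree p ((l + 1) div 2)"
    unfolding tm_agree_def
  proof (intro allI impI)
    fix i assume "i < (l + 1) div 2"
    then have "2 * i < l" by linarith
    then have "tm_letter (2 * i) = tm_letter (2 * i + 2 * p)"
      using A unfolding tm_agree_def by blast
    then show "tm_letter i = tm_letter (i + p)"
      by (metis distrib_left tm_letter_double)
  qed
next
  assume A: "tm_agree p ((l + 1) div 2)"
  show "tm_agree (2 * p) l"
    unfolding tm_agree_def
  proof (intro allI impI)
    fix i assume i: "i < l"
    show "tm_letter i = tm_letter (i + 2 * p)"
    proof (cases "even i")
      case True
      then obtain j where j: "i = 2 * j" by blast
      then have "tm_letter j = tm_letter (j + p)"
        using A i unfolding tm_agree_def by auto
      then show ?thesis
        unfolding j by (metis distrib_left tm_letter_double)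
    next
      case False
      then obtain j where j: "i = Suc (2 * j)" by (metis oddE Suc_eq_plus1)
      then have "tm_letter j = tm_letter (j + p)"
        using A i unfolding tm_agree_def by auto
      then have "tm_letter (Suc (2 * j)) = tm_letter (Suc (2 * (j + p)))"
        unfolding tm_letter_Suc_double by simp
      then show ?thesis
        unfolding j by (simp only: distrib_left add_Suc)
    qed
  qed
qed

text \<open>At an odd position the two letters 11 of the prefix 011 would fall into a single block of the
  morphism.\<close>

lemma tm_agree_odd_le:
  assumes "odd p" "tm_agree p l"
  shows "l \<le> 2"
proof (rule ccontr)
  assume "\<not> l \<le> 2"
  with assms(2) have 1: "tm_letter (1 + p) = tm_letter 1" and 2: "tm_letter (2 + p) = tm_letter 2"
    unfolding tm_agree_def by (metis less_trans not_le one_less_numeral_iff semiring_norm(76))+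
  from assms(1) obtain j where "p = Suc (2 * j)" by (metis oddE Suc_eq_plus1)
  then have "tm_letter (1 + p) = tm_letter (2 * (j + 1))"
    and "tm_letter (2 + p) = tm_letter (Suc (2 * (j + 1)))"
    by simp_all
  with 1 2 show False
    unfolding tm_letter_double tm_letter_Suc_double by simp
qed

text \<open>Halving \<open>p\<close> preserves the inequality, since the overlap is rounded up. At
  an odd \<open>p\<close> the overlap has at most two letters, which settles
  \<open>p \<ge> 3\<close>, with equality for \<open>p = 3\<close>, \<open>l = 2\<close>; the shift
  by 1 fails at the first letter.\<close>

lemma tm_agree_bound: "tm_agree p l \<Longrightarrow> 1 \<le> p \<Longrightarrow> 3 * l \<le> 2 * p"
proof (induction p arbitrary: l rule: less_induct)
  case (less p)
  show ?case
  proof (cases "even p")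
    case True
    then obtain q where q: "p = 2 * q" by blast
    with less.prems have "3 * ((l + 1) div 2) \<le> 2 * q"
      by (intro less.IH) (simp_all add: tm_agree_double)
    then show ?thesis unfolding q by linarith
  next
    case False
    with less.prems have l: "l \<le> 2" by (intro tm_agree_odd_le)
    show ?thesis
    proof (cases "p = 1")
      case True
      with less.prems have "l = 0"
        by (cases "l = 0") (auto simp: tm_agree_def)
      then show ?thesis by simp
    next
      case False
      with \<open>odd p\<close> have "p \<ge> 3" by presburger
      with l show ?thesis by linarith
    qed
  qed
qed

section \<open>Exponents of prefixes\<close>

lemma is_period_length: "w \<noteq> [] \<Longrightarrow> is_period w (length w)"
  by (auto simp: is_period_def Suc_le_eq)

lemma is_period_per: "w \<noteq> [] \<Longrightarrow> is_period w (per w)"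
  unfolding per_def by (rule LeastI) (rule is_period_length)

lemma expo_stake_thue_morse_le:
  assumes "1 \<le> n"
  shows "expo (stake n thue_morse) \<le> 5 / 3"
proof -
  let ?p = "per (stake n thue_morse)"
  have "stake n thue_morse \<noteq> []"
    using assms by simp
  from is_period_per[OF this] have p: "1 \<le> ?p" "?p \<le> n" "tm_agree ?p (n - ?p)"
    by (simp_all add: is_period_stake_thue_morse)
  have "3 * n \<le> 5 * ?p"
    using tm_agree_bound[OF p(3,1)] p(2) by linarith
  then have "3 * real n \<le> 5 * real ?p" by linarith
  then show ?thesis
    using p(1) by (simp add: expo_def field_simps)
qed

text \<open>The prefix 01101 thus has exponent at least \<open>5 / 3\<close>; the reverse inequality
  is \<open>expo_stake_thue_morse_le\<close>.\<close>

lemma per_stake_5_thue_morse: "per (stake 5 thue_morse) \<le> 3"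
proof -
  have "tm_letter (Suc 3) = 1"
    using tm_letter_double[of 2] by simp
  then have "is_period (stake 5 thue_morse) 3"
    by (auto simp: is_period_stake_thue_morse tm_agree_def less_2_cases_iff)
  then show ?thesis
    unfolding per_def by (rule Least_le)
qed

lemma ice_stake_thue_morse:
  assumes "5 \<le> n"
  shows "ice (stake n thue_morse) = 5 / 3"
  unfolding ice_def
proof (rule cSup_eq_maximum)
  have ne: "stake 5 thue_morse \<noteq> []"
    by simp
  have "1 \<le> per (stake 5 thue_morse)"
    using is_period_per[OF ne] by (simp add: is_period_def)
  with per_stake_5_thue_morse have "5 / 3 \<le> expo (stake 5 thue_morse)"
    unfolding expo_def length_stake by (intro frac_le) simp_all
  then have "expo (stake 5 thue_morse) = 5 / 3"
    using expo_stake_thue_morse_le[of 5] by simp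
  moreover have "prefix (stake 5 thue_morse) (stake n thue_morse)"
    unfolding prefix_def using assms by (metis le_Suc_ex stake_add)
  ultimately show "5 / 3 \<in> {expo u | u. prefix u (stake n thue_morse) \<and> u \<noteq> []}"
    using ne by force
next
  fix x assume "x \<in> {expo u | u. prefix u (stake n thue_morse) \<and> u \<noteq> []}"
  then obtain u where u: "x = expo u" "prefix u (stake n thue_morse)" "u \<noteq> []" by blast
  from u(2) have "u = take (length u) (stake n thue_morse)" and "length u \<le> n"
    using prefix_length_le[OF u(2)] by (auto simp: prefix_def)
  then have "u = stake (length u) thue_morse"
    by (simp add: take_stake min_absorb1)
  moreover have "1 \<le> length u"
    using u(3) by (simp add: Suc_le_eq)
  ultimately show "x \<le> 5 / 3"
    unfolding u(1) by (metis expo_stake_thue_morse_le)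
qed

section \<open>Counting periods by parity\<close>

text \<open>\<open>N\<close> is the last position of the prefix, whose length is thus \<open>N + 1\<close>.\<close>

definition tm_periods :: "nat \<Rightarrow> nat set" where
  "tm_periods N = {p. 1 \<le> p \<and> p \<le> N \<and> tm_agree p (N + 1 - p)}"

lemma finite_tm_periods [simp]: "finite (tm_periods N)"
  by (rule finite_subset[of _ "{..N}"]) (auto simp: tm_periods_def)

lemma nnp_stake_thue_morse: "nnp (stake (N + 1) thue_morse) = card (tm_periods N)"
  unfolding nnp_def tm_periods_def is_period_stake_thue_morse
  by (rule arg_cong[of _ _ card]) auto

text \<open>The only candidate for an odd period is the odd one of \<open>N\<close> and
  \<open>N - 1\<close>. The overlap is then one or two letters, compared with the initial 0 or
  01.\<close>

definition odd_period :: "nat \<Rightarrow> bool" where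
  "odd_period N \<longleftrightarrow> (if odd N then tm_letter N = 0 else tm_letter (N - 1) = 0 \<and> tm_letter N = 1)"

lemma odd_tm_periods:
  "{p \<in> tm_periods N. odd p} = (if odd_period N then {if odd N then N else N - 1} else {})"
proof -
  have *: "p \<in> tm_periods N \<longleftrightarrow> odd_period N \<and> p = (if odd N then N else N - 1)" if "odd p" for p
  proof (cases "p = (if odd N then N else N - 1)")
    case True
    have "p \<ge> 1" using that by (simp add: odd_pos Suc_le_eq)
    show ?thesis
    proof (cases "odd N")
      case False
      then have "N = Suc p" using True \<open>p \<ge> 1\<close> by simp
      then have "N + 1 - p = 2" by simp
      moreover have "(\<forall>i<2. P i) \<longleftrightarrow> P 0 \<and> P (Suc 0)" for P :: "nat \<Rightarrow> bool"
        by (auto simp: less_2_cases_iff)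
      ultimately show ?thesis
        unfolding tm_periods_def tm_agree_def odd_period_def
        using \<open>p \<ge> 1\<close> that \<open>N = Suc p\<close> by auto
    qed (use True \<open>p \<ge> 1\<close> in \<open>auto simp: tm_periods_def tm_agree_def odd_period_def\<close>)
  next
    case False
    have "p \<notin> tm_periods N"
    proof
      assume p: "p \<in> tm_periods N"
      then have "N + 1 - p \<le> 2" "p \<le> N"
        using tm_agree_odd_le[OF that] by (auto simp: tm_periods_def)
      then have "p = N \<or> p = N - 1" by linarith
      then show False using False that \<open>p \<le> N\<close> by (auto split: if_splits)
    qed
    with False show ?thesis by simp
  qed
  \<comment> \<open>At \<open>N = 0\<close> the truncated \<open>N - 1\<close> is 0, so
    \<open>odd_period\<close> makes contradictory demands on one letter and fails.\<close>
  have "odd (if odd N then N else N - 1)" if "odd_period N"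
    using that by (cases "N = 0") (auto simp: odd_period_def)
  then show ?thesis using * by (cases "odd_period N") auto
qed

text \<open>Length \<open>N + 1\<close> halved and rounded up is \<open>N div 2 + 1\<close>, so
  indexing by the last position turns the rounding up into plain \<open>div\<close>.\<close>

lemma even_tm_periods: "{p \<in> tm_periods N. even p} = (\<lambda>p. 2 * p) ` tm_periods (N div 2)"
proof -
  have "2 * p \<in> tm_periods N \<longleftrightarrow> p \<in> tm_periods (N div 2)" for p
  proof -
    have "2 * p \<le> N \<longleftrightarrow> p \<le> N div 2" by linarith
    moreover have "(N + 1 - 2 * p + 1) div 2 = N div 2 + 1 - p" if "2 * p \<le> N"
      using that by linarith
    ultimately show ?thesis
      by (auto simp: tm_periods_def tm_agree_double)
  qed
  then show ?thesis by (auto elim!: evenE)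
qed

lemma card_tm_periods:
  "card (tm_periods N) = of_bool (odd_period N) + card (tm_periods (N div 2))"
proof -
  have "card (tm_periods N) = card ({p \<in> tm_periods N. odd p} \<union> {p \<in> tm_periods N. even p})"
    by (rule arg_cong[of _ _ card]) auto
  also have "\<dots> = card {p \<in> tm_periods N. odd p} + card {p \<in> tm_periods N. even p}"
    by (rule card_Un_disjoint) auto
  also have "card {p \<in> tm_periods N. odd p} = of_bool (odd_period N)"
    by (simp add: odd_tm_periods)
  also have "card {p \<in> tm_periods N. even p} = card (tm_periods (N div 2))"
    unfolding even_tm_periods by (rule card_image) (simp add: inj_on_def)
  finally show ?thesis .
qed

lemma tm_periods_0 [simp]: "tm_periods 0 = {}"
  by (auto simp: tm_periods_def)

section \<open>Upper bound on the number of periods\<close>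

text \<open>A potential on the binary expansion. Reading \<open>N\<close>, \<open>N div 2\<close>, \<open>N div 4\<close>, \dots, two consecutive
  numbers with an odd period are possible (an odd one followed by an even one), but they are paid
  for by a later gap of length two.\<close>

definition potential :: "nat \<Rightarrow> nat" where
  "potential N =
    (if odd N \<and> tm_letter N = 0 then 2
     else if even N \<and> tm_letter N = 1 \<and> tm_letter (N - 1) = 1 then 0
     else 1)"

lemma potential_le: "potential N \<le> 2"
  by (simp add: potential_def)

text \<open>An amortised count: each halving earns 1 and each odd period costs 2, so on average at
  most every second halving can yield an odd period.\<close>

lemma potential_step: "2 * of_bool (odd_period N) + potential (N div 2) \<le> potential N + 1"
proof (cases "N < 4")
  case True
  then have "N \<in> {0, 1, 2, 3}" by auto
  then show ?thesis by (auto simp: potential_def odd_period_def)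
next
  case False
  \<comment> \<open>Given the residue \<open>r\<close>, the letters at \<open>c\<close> and
    \<open>c + 1\<close> determine all letters involved. Starting one block of four early also
    covers position \<open>N - 1\<close> when \<open>r = 0\<close>.\<close>
  define c r where "c = N div 4 - 1" and "r = N mod 4"
  have N: "N = 4 * c + 4 + r" and r: "r < 4"
    using False unfolding c_def r_def by presburger+
  have t: "tm_letter (4 * c + 3) = tm_letter c"
    "tm_letter (4 * c + 4) = tm_letter (c + 1)"
    "tm_letter (4 * c + 5) = tm_letter (c + 1) + 1"
    "tm_letter (4 * c + 6) = tm_letter (c + 1) + 1"
    "tm_letter (4 * c + 7) = tm_letter (c + 1)"
    "tm_letter (2 * c + 1) = tm_letter c + 1"
    "tm_letter (2 * c + 2) = tm_letter (c + 1)"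
    "tm_letter (2 * c + 3) = tm_letter (c + 1) + 1"
  proof -
    have "4 * c + 3 = Suc (2 * Suc (2 * c))" "4 * c + 4 = 2 * (2 * (c + 1))"
      "4 * c + 5 = Suc (2 * (2 * (c + 1)))" "4 * c + 6 = 2 * Suc (2 * (c + 1))"
      "4 * c + 7 = Suc (2 * Suc (2 * (c + 1)))" "2 * c + 1 = Suc (2 * c)"
      "2 * c + 2 = 2 * (c + 1)" "2 * c + 3 = Suc (2 * (c + 1))"
      by simp_all
    note eqs = this
    show "tm_letter (4 * c + 3) = tm_letter c" "tm_letter (4 * c + 4) = tm_letter (c + 1)"
      "tm_letter (4 * c + 5) = tm_letter (c + 1) + 1"
      "tm_letter (4 * c + 6) = tm_letter (c + 1) + 1" "tm_letter (4 * c + 7) = tm_letter (c + 1)"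
      "tm_letter (2 * c + 1) = tm_letter c + 1" "tm_letter (2 * c + 2) = tm_letter (c + 1)"
      "tm_letter (2 * c + 3) = tm_letter (c + 1) + 1"
      unfolding eqs tm_letter_double tm_letter_Suc_double by (simp_all add: add.assoc)
  qed
  note defs = potential_def odd_period_def
  from r consider "r = 0" | "r = 1" | "r = 2" | "r = 3" by linarith
  then show ?thesis
  proof cases
    case 1
    with N have h: "N = 4 * c + 4" "N - 1 = 4 * c + 3" "N div 2 = 2 * c + 2" "N div 2 - 1 = 2 * c + 1"
      by linarith+
    have "tm_letter N = tm_letter (c + 1)" "tm_letter (N - 1) = tm_letter c"
      "tm_letter (N div 2) = tm_letter (c + 1)" "tm_letter (N div 2 - 1) = tm_letter c + 1"
      using t h by metis+
    moreover have "even N" "even (N div 2)"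
      using h by simp_all
    ultimately show ?thesis
      by (cases "tm_letter c"; cases "tm_letter (c + 1)") (simp_all add: defs)
  next
    case 2
    with N have h: "N = 4 * c + 5" "N div 2 = 2 * c + 2" "N div 2 - 1 = 2 * c + 1"
      by linarith+
    have "tm_letter N = tm_letter (c + 1) + 1"
      "tm_letter (N div 2) = tm_letter (c + 1)" "tm_letter (N div 2 - 1) = tm_letter c + 1"
      using t h by metis+
    moreover have "odd N" "even (N div 2)"
      using h by simp_all
    ultimately show ?thesis
      by (cases "tm_letter c"; cases "tm_letter (c + 1)") (simp_all add: defs)
  next
    case 3
    with N have h: "N = 4 * c + 6" "N - 1 = 4 * c + 5" "N div 2 = 2 * c + 3"
      by linarith+
    have "tm_letter N = tm_letter (c + 1) + 1" "tm_letter (N - 1) = tm_letter (c + 1) + 1"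
      "tm_letter (N div 2) = tm_letter (c + 1) + 1"
      using t h by metis+
    moreover have "even N" "odd (N div 2)"
      using h by simp_all
    ultimately show ?thesis
      by (cases "tm_letter (c + 1)") (simp_all add: defs)
  next
    case 4
    with N have h: "N = 4 * c + 7" "N div 2 = 2 * c + 3"
      by linarith+
    have "tm_letter N = tm_letter (c + 1)"
      "tm_letter (N div 2) = tm_letter (c + 1) + 1"
      using t h by metis+
    moreover have "odd N" "odd (N div 2)"
      using h by simp_all
    ultimately show ?thesis
      by (cases "tm_letter (c + 1)") (simp_all add: defs)
  qed
qed

text \<open>\<open>potential_step\<close> telescopes over the \<open>K\<close> halvings that bring
  \<open>N\<close> to 0.\<close>

lemma card_tm_periods_le: "N < 2 ^ K \<Longrightarrow> 2 * card (tm_periods N) \<le> K + potential N"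
proof (induction K arbitrary: N)
  case (Suc K)
  then have "N div 2 < 2 ^ K" by auto
  from Suc.IH[OF this] show ?case
    using card_tm_periods[of N] potential_step[of N] by linarith
qed simp

section \<open>Lengths with extremal numbers of periods\<close>

lemma tm_letter_power_2_minus_1: "tm_letter (2 ^ k - 1) = of_bool (odd k)"
proof (induction k)
  case (Suc k)
  have "(2 ^ Suc k - 1 :: nat) = Suc (2 * (2 ^ k - 1))"
    using one_le_power[of "2 :: nat" k] unfolding power_Suc by linarith
  then show ?case using Suc by simp
qed simp

text \<open>Halving runs through the odd numbers \<open>2 ^ j - 1\<close> with \<open>j\<close> from
  \<open>2 * k\<close> down to 1. Such a number has an odd period iff its letter is 0, that is, iff
  \<open>j\<close> is even.\<close>

lemma card_tm_periods_power_4: "card (tm_periods (4 ^ k - 1)) = k"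
proof -
  have step: "card (tm_periods (2 ^ Suc k - 1)) = of_bool (odd k) + card (tm_periods (2 ^ k - 1))" for k
  proof -
    have "(2 ^ Suc k - 1 :: nat) = Suc (2 * (2 ^ k - 1))"
      using one_le_power[of "2 :: nat" k] unfolding power_Suc by linarith
    then have "odd (2 ^ Suc k - 1 :: nat)" and "(2 ^ Suc k - 1 :: nat) div 2 = 2 ^ k - 1"
      by simp_all
    then show ?thesis
      using tm_letter_power_2_minus_1[of "Suc k"]
      by (subst card_tm_periods) (simp add: odd_period_def del: power_Suc)
  qed
  have "card (tm_periods (2 ^ (2 * k) - 1)) = k"
  proof (induction k)
    case (Suc k)
    then show ?case
      using step[of "2 * k"] step[of "Suc (2 * k)"] by simp
  qed simp
  then show ?thesis by (simp add: power_mult)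
qed

text \<open>The letter at \<open>3 * 2 ^ k\<close> is 0, whereas an odd period at an even position
  requires letter 1. Only the final 3 contributes; 1 has letter 1 and does not.\<close>

lemma card_tm_periods_3_power_2: "card (tm_periods (3 * 2 ^ k)) = 1"
proof (induction k)
  case 0
  have "card (tm_periods 3) = 1"
    by (simp add: card_tm_periods[of 3] card_tm_periods[of "Suc 0"] odd_period_def)
  then show ?case by simp
next
  case (Suc k)
  have "tm_letter (3 * 2 ^ k) = 0" for k
  proof (induction k)
    case (Suc k)
    then show ?case
      using tm_letter_double[of "3 * 2 ^ k"] by simp
  qed simp
  from this[of "Suc k"] have "\<not> odd_period (3 * 2 ^ Suc k)"
    by (simp add: odd_period_def)
  then show ?case
    using Suc by (subst card_tm_periods) simp
qed

section \<open>The two limits\<close>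

lemma period_ratio_stake_thue_morse:
  assumes "4 \<le> N"
  shows "period_ratio (stake (N + 1) thue_morse) =
    3 * real (card (tm_periods N)) / (5 * ln (real N + 1))"
  using ice_stake_thue_morse[of "N + 1"] assms
  by (simp only: period_ratio_def nnp_stake_thue_morse) (simp add: add.commute)

text \<open>Rounding the binary logarithm up costs at most 1 and the potential at most 2; after
  halving, the resulting 3/2 is relaxed to 2.\<close>

lemma card_tm_periods_le_log:
  assumes "1 \<le> N"
  shows "real (card (tm_periods N)) \<le> ln (real N + 1) / (2 * ln 2) + 2"
proof -
  define K where "K = nat \<lceil>log 2 (real N + 1)\<rceil>"
  have nn: "0 \<le> log 2 (real N + 1)" using assms by simp
  then have "log 2 (real N + 1) \<le> real K" unfolding K_def by linarith
  then have "real N + 1 \<le> 2 powr real K" using assms by (simp add: log_le_iff)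
  then have "real N < real (2 ^ K)"
    by (simp add: powr_realpow del: of_nat_less_iff of_nat_less_numeral_power_cancel_iff)
  then have "N < 2 ^ K" by (simp only: of_nat_less_iff)
  then have "2 * card (tm_periods N) \<le> K + 2"
    using card_tm_periods_le potential_le[of N] by (meson add_left_mono le_trans)
  then have "2 * real (card (tm_periods N)) \<le> real K + 2" by linarith
  also have "real K \<le> log 2 (real N + 1) + 1" using nn unfolding K_def by linarith
  finally show ?thesis by (simp add: log_def)
qed

lemma upper_period_ratio_thue_morse: "upper_period_ratio thue_morse = ereal (3 / (10 * ln 2))"
proof (rule antisym)
  let ?f = "\<lambda>n. period_ratio (stake n thue_morse)"
  \<comment> \<open>The second summand is the additive 2 of \<open>card_tm_periods_le_log\<close>
    times 3/5, over the logarithm; it vanishes in the limit.\<close>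
  let ?g = "\<lambda>n. 3 / (10 * ln 2) + 6 / (5 * ln (real n))"
  have "?f n \<le> ?g n" if "5 \<le> n" for n
  proof -
    define N where "N = n - 1"
    with that have N: "n = N + 1" "4 \<le> N" by simp_all
    have l: "ln (real N + 1) > 0" using N by simp
    have "?f n = 3 * real (card (tm_periods N)) / (5 * ln (real N + 1))"
      using N by (simp only: period_ratio_stake_thue_morse)
    also have "\<dots> \<le> 3 * (ln (real N + 1) / (2 * ln 2) + 2) / (5 * ln (real N + 1))"
      using N l card_tm_periods_le_log[of N]
      by (intro divide_right_mono mult_left_mono) auto
    also have "\<dots> = ?g n"
      using l N by (simp add: field_simps)
    finally show ?thesis .
  qed
  then have "upper_period_ratio thue_morse \<le> limsup (\<lambda>n. ereal (?g n))"
    unfolding upper_period_ratio_def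
    by (intro Limsup_mono eventually_sequentiallyI[of 5]) simp
  also have "limsup (\<lambda>n. ereal (?g n)) = ereal (3 / (10 * ln 2))"
  proof (rule lim_imp_Limsup)
    have "?g \<longlonglongrightarrow> 3 / (10 * ln 2)"
      by real_asymp
    then show "(\<lambda>n. ereal (?g n)) \<longlonglongrightarrow> ereal (3 / (10 * ln 2))" by simp
  qed simp
  finally show "upper_period_ratio thue_morse \<le> ereal (3 / (10 * ln 2))" .
next
  let ?f = "\<lambda>n. period_ratio (stake n thue_morse)"
  \<comment> \<open>Along powers of 4 the count is exactly the exponent, so the ratio is constant.
    The offset 2 keeps the length at least 5.\<close>
  define r :: "nat \<Rightarrow> nat" where "r k = 4 ^ (k + 2)" for k
  have "strict_mono r" by (simp add: r_def strict_mono_Suc_iff)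
  have "?f (r k) = 3 / (10 * ln 2)" for k
  proof -
    have "(4 :: nat) ^ 2 \<le> 4 ^ (k + 2)" by (rule power_increasing) simp_all
    then have "16 \<le> r k" unfolding r_def by simp
    then have "4 \<le> r k - 1" "1 \<le> r k" by simp_all
    then have "?f (r k) = 3 * real (card (tm_periods (r k - 1))) / (5 * ln (real (r k)))"
      using period_ratio_stake_thue_morse[of "r k - 1"] by (simp add: of_nat_diff)
    also have "\<dots> = 3 * real (k + 2) / (5 * (real (k + 2) * ln 4))"
      unfolding r_def card_tm_periods_power_4 of_nat_power by (subst ln_realpow) simp_all
    also have "ln (4 :: real) = 2 * ln 2"
      using ln_realpow[of 2 2] by simp
    finally have "?f (r k) = 3 * real (k + 2) / (5 * (real (k + 2) * (2 * ln 2)))" .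
    moreover have "3 * x / (5 * (x * (2 * ln 2))) = 3 / (10 * ln 2)" if "x \<noteq> 0" for x :: real
      using that by simp
    ultimately show ?thesis by (metis add_2_eq_Suc' nat.distinct(2) of_nat_eq_0_iff)
  qed
  then have "ereal (3 / (10 * ln 2)) = limsup ((\<lambda>n. ereal (?f n)) \<circ> r)"
    by (simp add: o_def Limsup_const)
  also have "\<dots> \<le> limsup (\<lambda>n. ereal (?f n))"
    by (rule limsup_subseq_mono) fact
  finally show "ereal (3 / (10 * ln 2)) \<le> upper_period_ratio thue_morse"
    by (simp add: upper_period_ratio_def)
qed

lemma lower_period_ratio_thue_morse: "lower_period_ratio thue_morse = 0"
proof (rule antisym)
  let ?f = "\<lambda>n. period_ratio (stake n thue_morse)"
  \<comment> \<open>These lengths have a single nontrivial period while the logarithm grows. The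
    offset 1 ensures a last position of at least 4.\<close>
  define r :: "nat \<Rightarrow> nat" where "r k = 3 * 2 ^ (k + 1) + 1" for k
  have "strict_mono r" by (simp add: r_def strict_mono_Suc_iff)
  have "?f (r k) = 3 / (5 * ln (3 * 2 ^ (k + 1) + 1))" for k
  proof -
    have "4 \<le> (3 * 2 ^ (k + 1) :: nat)"
      by (induction k) simp_all
    from period_ratio_stake_thue_morse[OF this] show ?thesis
      unfolding r_def card_tm_periods_3_power_2 by simp
  qed
  moreover have "(\<lambda>k :: nat. 3 / (5 * ln (3 * 2 ^ (k + 1) + 1)) :: real) \<longlonglongrightarrow> 0"
    by real_asymp
  ultimately have "((\<lambda>n. ereal (?f n)) \<circ> r) \<longlonglongrightarrow> 0"
    by (simp add: o_def zero_ereal_def)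
  then have "liminf ((\<lambda>n. ereal (?f n)) \<circ> r) = 0"
    by (intro lim_imp_Liminf) simp_all
  then show "lower_period_ratio thue_morse \<le> 0"
    unfolding lower_period_ratio_def using liminf_subseq_mono[OF \<open>strict_mono r\<close>] by metis
next
  have "0 \<le> period_ratio (stake n thue_morse)" if "5 \<le> n" for n
    using that by (simp add: period_ratio_def ice_stake_thue_morse)
  then show "0 \<le> lower_period_ratio thue_morse"
    unfolding lower_period_ratio_def
    by (intro Liminf_bounded eventually_sequentiallyI[of 5]) simp
qed

theorem theorem15:
  shows "upper_period_ratio thue_morse = ereal (3 / (10 * ln 2)) \<and>
    \<bar>3 / (10 * ln 2) - (0.4328 :: real)\<bar> < 0.00005 \<and>
    lower_period_ratio thue_morse = 0"
proof -
  have "6931 / 10000 \<le> ln (2 :: real)" "ln (2 :: real) \<le> 6932 / 10000"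
    using ln_approx_bounds[of 2 4] by (simp_all add: eval_nat_numeral)
  \<comment> \<open>The endpoints are 0.4328 minus and plus the tolerance 0.00005.\<close>
  then have "43275 / 100000 < 3 / (10 * ln 2 :: real)" "3 / (10 * ln 2 :: real) < 43285 / 100000"
    by (simp_all add: field_simps)
  moreover have "\<bar>c - 0.4328\<bar> < 0.00005" if "43275 / 100000 < c" "c < 43285 / 100000" for c :: real
    unfolding abs_less_iff using that by simp
  ultimately have "\<bar>3 / (10 * ln 2) - (0.4328 :: real)\<bar> < 0.00005"
    by blast
  then show ?thesis
    using upper_period_ratio_thue_morse lower_period_ratio_thue_morse by blast
qed

end
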